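(* No element of the comeager conjugacy class of $\mathcal H(\{0,1\}^{\mathbb N})$ has a Li-Yorke pair.
   Context: $\{0,1\}^{\mathbb N}$ ($\mathbb N$ the positive integers) has the product topology and the metric $d(\sigma,\tau)=1/n$, where $n$ is the least positive integer with $\sigma(n)\neq\tau(n)$, and $d(\sigma,\sigma)=0$. $\mathcal H(\{0,1\}^{\mathbb N})$ is the group of all homeomorphisms of $\{0,1\}^{\mathbb N}$ onto itself, with the topology given by the metric $\tilde d(f,g)=\max_\sigma d(f(\sigma),g(\sigma))$. This group has a conjugacy class that is a comeager subset (necessarily unique), called the comeager conjugacy class of $\mathcal H(\{0,1\}^{\mathbb N})$. A pair $(x,y)$ is a Li-Yorke pair for a map $f$ if $\liminf_{n\to\infty}d(f^n(x),f^n(y))=0$ and $\limsup_{n\to\infty}d(f^n(x),f^n(y))>0$. *)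

theory Defs
  imports "HOL-Analysis.Analysis"
begin

text \<open>
  Points of the Cantor space are functions of type \<^typ>\<open>nat \<Rightarrow> bool\<close>, which carry the product
  topology through the type class instances of \<^theory>\<open>HOL-Analysis.Function_Topology\<close>.  The
  coordinates are indexed from 0 here and by the positive integers in the mathematics: index
  \<open>k\<close> stands for the positive integer \<open>k + 1\<close>, whence the \<^const>\<open>Suc\<close> in the metric.
\<close>

type_synonym cantor = "nat \<Rightarrow> bool"

definition cantor_dist :: "cantor \<Rightarrow> cantor \<Rightarrow> real" where
  "cantor_dist \<sigma> \<tau> = (if \<sigma> = \<tau> then 0 else 1 / real (Suc (LEAST k. \<sigma> k \<noteq> \<tau> k)))"

definition cantor_homeos :: "(cantor \<Rightarrow> cantor) set" where
  "cantor_homeos = {f. homeomorphism UNIV UNIV f (inv f)}"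

text \<open>The supremum is attained, see \<open>cantor_sup_dist_attained\<close> below.\<close>

definition cantor_sup_dist :: "(cantor \<Rightarrow> cantor) \<Rightarrow> (cantor \<Rightarrow> cantor) \<Rightarrow> real" where
  "cantor_sup_dist f g = (SUP \<sigma>. cantor_dist (f \<sigma>) (g \<sigma>))"

definition cantor_homeos_topology :: "(cantor \<Rightarrow> cantor) topology" where
  "cantor_homeos_topology = Metric_space.mtopology cantor_homeos cantor_sup_dist"

definition conjugacy_class :: "(cantor \<Rightarrow> cantor) set \<Rightarrow> bool" where
  "conjugacy_class C \<longleftrightarrow> (\<exists>f\<in>cantor_homeos. C = {h \<circ> f \<circ> inv h | h. h \<in> cantor_homeos})"

definition nowhere_dense_in :: "'a topology \<Rightarrow> 'a set \<Rightarrow> bool" where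
  "nowhere_dense_in X S \<longleftrightarrow> S \<subseteq> topspace X \<and> X interior_of (X closure_of S) = {}"

definition meager_in :: "'a topology \<Rightarrow> 'a set \<Rightarrow> bool" where
  "meager_in X S \<longleftrightarrow> (\<exists>N::nat \<Rightarrow> 'a set. (\<forall>n. nowhere_dense_in X (N n)) \<and> S = (\<Union>n. N n))"

definition comeager_in :: "'a topology \<Rightarrow> 'a set \<Rightarrow> bool" where
  "comeager_in X S \<longleftrightarrow> S \<subseteq> topspace X \<and> meager_in X (topspace X - S)"

definition Li_Yorke_pair :: "(cantor \<Rightarrow> cantor) \<Rightarrow> cantor \<Rightarrow> cantor \<Rightarrow> bool" where
  "Li_Yorke_pair f x y \<longleftrightarrow>
     liminf (\<lambda>n. ereal (cantor_dist ((f ^^ n) x) ((f ^^ n) y))) = 0 \<and>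
     limsup (\<lambda>n. ereal (cantor_dist ((f ^^ n) x) ((f ^^ n) y))) > 0"

lemma cantor_dist_less_iff:
  "cantor_dist \<sigma> \<tau> < 1 / real (Suc n) \<longleftrightarrow> (\<forall>k\<le>n. \<sigma> k = \<tau> k)"
proof (cases "\<sigma> = \<tau>")
  case False
  define m where "m = (LEAST k. \<sigma> k \<noteq> \<tau> k)"
  have "\<exists>k. \<sigma> k \<noteq> \<tau> k"
    using False by blast
  then have m: "\<sigma> m \<noteq> \<tau> m"
    unfolding m_def by (rule LeastI_ex)
  have m': "\<sigma> k = \<tau> k" if "k < m" for k
    using not_less_Least[of k "\<lambda>k. \<sigma> k \<noteq> \<tau> k"] that unfolding m_def by blast
  have "cantor_dist \<sigma> \<tau> = 1 / real (Suc m)"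
    using False by (simp add: cantor_dist_def m_def)
  then have "cantor_dist \<sigma> \<tau> < 1 / real (Suc n) \<longleftrightarrow> n < m"
    by (simp add: frac_less2 divide_less_eq less_divide_eq)
  also have "n < m \<longleftrightarrow> (\<forall>k\<le>n. \<sigma> k = \<tau> k)"
  proof
    assume "n < m"
    then show "\<forall>k\<le>n. \<sigma> k = \<tau> k" using m' by simp
  next
    assume "\<forall>k\<le>n. \<sigma> k = \<tau> k"
    with m show "n < m" by (meson not_le)
  qed
  finally show ?thesis .
qed (simp add: cantor_dist_def)

lemma cantor_dist_nonneg: "0 \<le> cantor_dist \<sigma> \<tau>"
  and cantor_dist_le_1: "cantor_dist \<sigma> \<tau> \<le> 1"
  and cantor_dist_commute: "cantor_dist \<sigma> \<tau> = cantor_dist \<tau> \<sigma>"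
  and cantor_dist_eq_0: "cantor_dist \<sigma> \<tau> = 0 \<longleftrightarrow> \<sigma> = \<tau>"
  proof -
  have "(\<lambda>k. \<sigma> k \<noteq> \<tau> k) = (\<lambda>k. \<tau> k \<noteq> \<sigma> k)" by auto
  then show "cantor_dist \<sigma> \<tau> = cantor_dist \<tau> \<sigma>" by (simp only: cantor_dist_def eq_commute)
qed (auto simp: cantor_dist_def)

lemma cantor_dist_cases:
  obtains "cantor_dist \<sigma> \<tau> = 0" | m where "cantor_dist \<sigma> \<tau> = 1 / real (Suc m)"
  unfolding cantor_dist_def by (cases "\<sigma> = \<tau>") auto

lemma cantor_dist_ultra: "cantor_dist \<sigma> \<upsilon> \<le> max (cantor_dist \<sigma> \<tau>) (cantor_dist \<tau> \<upsilon>)"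
proof (cases rule: cantor_dist_cases[of \<sigma> \<upsilon>])
  case 1
  then show ?thesis by (simp add: cantor_dist_nonneg le_max_iff_disj)
next
  case (2 m)
  have False if "max (cantor_dist \<sigma> \<tau>) (cantor_dist \<tau> \<upsilon>) < 1 / real (Suc m)"
  proof -
    have "\<forall>k\<le>m. \<sigma> k = \<tau> k" "\<forall>k\<le>m. \<tau> k = \<upsilon> k"
      using that unfolding max_less_iff_conj cantor_dist_less_iff by blast+
    then have "cantor_dist \<sigma> \<upsilon> < 1 / real (Suc m)"
      unfolding cantor_dist_less_iff by simp
    with 2 show False by simp
  qed
  with 2 show ?thesis by (metis not_le)
qed

interpretation Cantor: Metric_space UNIV cantor_dist
proof
  show "cantor_dist x z \<le> cantor_dist x y + cantor_dist y z" for x y z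
    using cantor_dist_ultra[of x z y] cantor_dist_nonneg[of x y] cantor_dist_nonneg[of y z]
    by linarith
qed (auto simp: cantor_dist_nonneg cantor_dist_eq_0 intro: cantor_dist_commute)

lemma Cantor_mtopology: "Cantor.mtopology = euclidean"
proof -
  have "openin Cantor.mtopology U \<longleftrightarrow> open U" for U
  proof
    assume U: "openin Cantor.mtopology U"
    show "open U"
    proof (subst open_subopen, intro ballI)
      fix x assume "x \<in> U"
      then obtain r where r: "r > 0" "Cantor.mball x r \<subseteq> U"
        using U by (auto simp: Cantor.openin_mtopology)
      obtain n where n: "1 / real (Suc n) < r"
        using nat_approx_posE[OF r(1)] by auto
      define T where "T = Pi\<^sub>E UNIV (\<lambda>i. if i \<le> n then {x i} else UNIV)"
      have "open T"
        unfolding T_def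
        by (rule open_PiE) (auto simp: open_discrete intro: finite_subset[of _ "{..n}"])
      moreover have "x \<in> T" by (auto simp: T_def)
      moreover have "T \<subseteq> U"
      proof
        fix y assume "y \<in> T"
        then have "cantor_dist x y < 1 / real (Suc n)"
          unfolding cantor_dist_less_iff by (auto simp: T_def PiE_iff split: if_splits)
        with n r show "y \<in> U" by (auto simp: Cantor.mball_def)
      qed
      ultimately show "\<exists>T. open T \<and> x \<in> T \<and> T \<subseteq> U" by blast
    qed
  next
    assume U: "open U"
    show "openin Cantor.mtopology U"
      unfolding Cantor.openin_mtopology
    proof (intro conjI allI impI)
      fix x assume "x \<in> U"
      then obtain X where X: "x \<in> (\<Pi>\<^sub>E i\<in>UNIV. X i)" "finite {i. X i \<noteq> UNIV}"
          "(\<Pi>\<^sub>E i\<in>UNIV. X i) \<subseteq> U"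
        using U product_topology_open_contains_basis[of "\<lambda>_. euclidean" UNIV U x]
        unfolding open_fun_def by auto
      then obtain n where n: "\<And>i. X i \<noteq> UNIV \<Longrightarrow> i \<le> n"
        unfolding finite_nat_set_iff_bounded_le by auto
      have "Cantor.mball x (1 / real (Suc n)) \<subseteq> U"
      proof
        fix y assume "y \<in> Cantor.mball x (1 / real (Suc n))"
        then have *: "\<forall>k\<le>n. x k = y k"
          unfolding Cantor.in_mball cantor_dist_less_iff by blast
        have "y i \<in> X i" for i
          proof (cases "i \<le> n")
            case True
            with * have "y i = x i" by simp
            with PiE_mem[OF X(1), of i] show ?thesis by simp
          next
            case False
            with n have "X i = UNIV" by blast
            then show ?thesis by simp
          qed
        with X(3) show "y \<in> U" by (auto simp: PiE_iff)
      qed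
      moreover have "(0::real) < 1 / real (Suc n)" by simp
      ultimately show "\<exists>r>0. Cantor.mball x r \<subseteq> U" by blast
    qed simp
  qed
  then show ?thesis
    by (simp add: topology_eq)
qed

lemma bdd_above_cantor_dist: "bdd_above (range (\<lambda>\<sigma>. cantor_dist (f \<sigma>) (g \<sigma>)))"
  by (rule bdd_aboveI2[of _ _ 1]) (rule cantor_dist_le_1)

lemma cantor_dist_le_sup_dist: "cantor_dist (f \<sigma>) (g \<sigma>) \<le> cantor_sup_dist f g"
  unfolding cantor_sup_dist_def by (rule cSUP_upper[OF _ bdd_above_cantor_dist]) simp

lemma cantor_sup_dist_attained: "\<exists>\<sigma>. cantor_dist (f \<sigma>) (g \<sigma>) = cantor_sup_dist f g"
proof (cases "f = g")
  case True
  then show ?thesis by (simp add: cantor_sup_dist_def cantor_dist_def)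
next
  case False
  define P where "P = (\<lambda>m. \<exists>\<sigma>. cantor_dist (f \<sigma>) (g \<sigma>) = 1 / real (Suc m))"
  have ex: "\<exists>m. P m"
  proof -
    obtain \<sigma> where "f \<sigma> \<noteq> g \<sigma>" using False by auto
    then show ?thesis
      using cantor_dist_cases[of "f \<sigma>" "g \<sigma>"] cantor_dist_eq_0 unfolding P_def by metis
  qed
  then obtain \<sigma> where \<sigma>: "cantor_dist (f \<sigma>) (g \<sigma>) = 1 / real (Suc (Least P))"
    using LeastI_ex[OF ex] unfolding P_def by blast
  have "cantor_dist (f \<tau>) (g \<tau>) \<le> cantor_dist (f \<sigma>) (g \<sigma>)" for \<tau>
  proof (cases rule: cantor_dist_cases[of "f \<tau>" "g \<tau>"])
    case 1
    then show ?thesis by (simp add: cantor_dist_nonneg)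
  next
    case (2 m)
    then have "Least P \<le> m" by (intro Least_le) (auto simp: P_def)
    then show ?thesis unfolding 2 \<sigma> by (intro divide_left_mono) auto
  qed
  then have "cantor_sup_dist f g \<le> cantor_dist (f \<sigma>) (g \<sigma>)"
    unfolding cantor_sup_dist_def by (intro cSUP_least) auto
  with cantor_dist_le_sup_dist[of f \<sigma> g] show ?thesis by force
qed

interpretation Cantor_homeos: Metric_space cantor_homeos cantor_sup_dist
proof
  show "0 \<le> cantor_sup_dist f g" for f g
    using cantor_sup_dist_attained cantor_dist_nonneg by metis
  show "cantor_sup_dist f g = cantor_sup_dist g f" for f g
    by (simp add: cantor_sup_dist_def cantor_dist_commute)
  show "cantor_sup_dist f g = 0 \<longleftrightarrow> f = g" for f g
  proof
    assume "cantor_sup_dist f g = 0"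
    then have "cantor_dist (f \<sigma>) (g \<sigma>) = 0" for \<sigma>
      using cantor_dist_le_sup_dist[of f \<sigma> g] cantor_dist_nonneg[of "f \<sigma>" "g \<sigma>"] by simp
    then show "f = g" by (auto simp: cantor_dist_eq_0)
  next
    assume "f = g"
    then show "cantor_sup_dist f g = 0" by (simp add: cantor_sup_dist_def cantor_dist_def)
  qed
  show "cantor_sup_dist f h \<le> cantor_sup_dist f g + cantor_sup_dist g h" for f g h
  proof -
    obtain \<sigma> where "cantor_dist (f \<sigma>) (h \<sigma>) = cantor_sup_dist f h"
      using cantor_sup_dist_attained by blast
    then show ?thesis
      using Cantor.triangle[of "f \<sigma>" "g \<sigma>" "h \<sigma>"] cantor_dist_le_sup_dist[of f \<sigma> g]
        cantor_dist_le_sup_dist[of g \<sigma> h] by simp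
  qed
qed

end

theory Submission
  imports Defs
begin

text \<open>
  The idea is to find a property of homeomorphisms that rules out Li-Yorke pairs, is invariant under
  conjugation, and holds on a dense \<open>G\<^sub>\<delta>\<close> set.  A comeager conjugacy class meets
  that set by Baire's theorem, so by invariance all its elements have the property.

  The property is the existence, for every \<open>k\<close>, of a clopen partition whose cells have diameter less
  than \<open>1 / (k + 1)\<close> and are divided into \<^emph>\<open>past\<close> and \<^emph>\<open>future\<close> cells, such that
  the future is forward invariant, a future cell determines the cell of the image point, and a past
  cell determines the cell of the preimage point.  Follow two orbits that share a cell infinitely
  often.  If they ever share a future cell, they share all cells from then on.  Otherwise they share
  past cells at arbitrarily late times and hence, going backwards from such a time, at all earlier
  times.  In both cases the orbits eventually stay in common cells
  (\<open>past_future_labelling_eventually_eq\<close>).  Now if the lower limit of the distances of two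
  orbits is \<open>0\<close>, they share a cell infinitely often, because cells are clopen; so they
  eventually stay in common cells for every \<open>k\<close>, and the upper limit is \<open>0\<close> as well.

  For fixed \<open>k\<close> the property depends only on the cells of the points \<open>f x\<close>, so it is open.  For
  density (\<open>tame_approximation\<close>), consider the cylinders of a fixed length.  For every cylinder
  \<open>a\<close> choose one cylinder that \<open>f ` a\<close> meets and one that \<open>inv f ` a\<close> meets.
  Split each cylinder into a future part, all of which is to go to the future part of the chosen
  successor, and a past part, which is to be covered by points from the past part of the chosen
  predecessor only.  The remaining points go to future parts.  All this prescribes only into which
  clopen pieces certain clopen sets are mapped.  Since any two nonempty clopen subsets of the Cantor
  space are homeomorphic, some homeomorphism realizes it (\<open>homeo_matching_labels\<close>), and it can be
  arranged that each point stays in the cylinder into which \<open>f\<close> maps it.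

  Baire's theorem applies because the topology of the group comes from the complete metric that
  measures the distance of the maps together with the distance of their inverses.
\<close>

section \<open>Agreement of initial segments\<close>

text \<open>
  The balls of the metric are the sets of points that share an initial segment, so all topological
  arguments can be phrased as statements about finitely many coordinates.
\<close>

definition agree :: "nat \<Rightarrow> cantor \<Rightarrow> cantor \<Rightarrow> bool" where
  "agree n x y \<longleftrightarrow> (\<forall>k\<le>n. x k = y k)"

lemma agree_refl [simp]: "agree n x x"
  and agree_sym: "agree n x y \<Longrightarrow> agree n y x"
  and agree_trans: "agree n x y \<Longrightarrow> agree n y z \<Longrightarrow> agree n x z"
  and agree_mono: "agree n x y \<Longrightarrow> m \<le> n \<Longrightarrow> agree m x y"
  by (auto simp: agree_def)

lemma agree_all_imp_eq: "(\<And>n. agree n x y) \<Longrightarrow> x = y"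
  by (auto simp: agree_def)

lemma agree_iff_dist: "agree n x y \<longleftrightarrow> cantor_dist x y < 1 / real (Suc n)"
  unfolding agree_def cantor_dist_less_iff ..

lemma sup_dist_less_iff: "cantor_sup_dist f g < 1 / real (Suc n) \<longleftrightarrow> (\<forall>x. agree n (f x) (g x))"
  unfolding agree_iff_dist
  by (metis cantor_dist_le_sup_dist cantor_sup_dist_attained le_less_trans)

lemma open_cantor_iff: "open U \<longleftrightarrow> (\<forall>x\<in>U. \<exists>n. \<forall>y. agree n x y \<longrightarrow> y \<in> U)"
proof -
  have "open U \<longleftrightarrow> (\<forall>x\<in>U. \<exists>r>0. \<forall>y. cantor_dist x y < r \<longrightarrow> y \<in> U)"
    unfolding open_openin Cantor_mtopology[symmetric] Cantor.openin_mtopology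
    by (auto simp: subset_iff)
  also have "\<dots> \<longleftrightarrow> (\<forall>x\<in>U. \<exists>n. \<forall>y. agree n x y \<longrightarrow> y \<in> U)"
  proof (intro ball_cong refl iffI)
    fix x assume "\<exists>r>0. \<forall>y. cantor_dist x y < r \<longrightarrow> y \<in> U"
    then obtain r where r: "r > 0" "\<And>y. cantor_dist x y < r \<Longrightarrow> y \<in> U" by blast
    obtain n where n: "1 / real (Suc n) < r" using nat_approx_posE[OF r(1)] by auto
    with r(2) show "\<exists>n. \<forall>y. agree n x y \<longrightarrow> y \<in> U"
      unfolding agree_iff_dist by (meson less_trans)
  next
    fix x assume "\<exists>n. \<forall>y. agree n x y \<longrightarrow> y \<in> U"
    then obtain n where n: "\<And>y. agree n x y \<Longrightarrow> y \<in> U" by blast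
    have "(0::real) < 1 / real (Suc n)" by simp
    with n show "\<exists>r>0. \<forall>y. cantor_dist x y < r \<longrightarrow> y \<in> U"
      unfolding agree_iff_dist by blast
  qed
  finally show ?thesis .
qed

lemma continuous_cantor_iff:
  "continuous_on UNIV f \<longleftrightarrow> (\<forall>x k. \<exists>m. \<forall>y. agree m x y \<longrightarrow> agree k (f x) (f y))"
  for f :: "cantor \<Rightarrow> cantor"
proof
  assume f: "continuous_on UNIV f"
  show "\<forall>x k. \<exists>m. \<forall>y. agree m x y \<longrightarrow> agree k (f x) (f y)"
  proof (intro allI)
    fix x k
    have "open {z. agree k (f x) z}"
      unfolding open_cantor_iff by (auto intro: agree_trans)
    then have "open (f -` {z. agree k (f x) z})"
      using f continuous_on_open_vimage[OF open_UNIV, of f] unfolding Int_UNIV_right by blast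
    moreover have "x \<in> f -` {z. agree k (f x) z}" by simp
    ultimately obtain m where "\<And>y. agree m x y \<Longrightarrow> y \<in> f -` {z. agree k (f x) z}"
      unfolding open_cantor_iff by blast
    then show "\<exists>m. \<forall>y. agree m x y \<longrightarrow> agree k (f x) (f y)"
      by auto
  qed
next
  assume R: "\<forall>x k. \<exists>m. \<forall>y. agree m x y \<longrightarrow> agree k (f x) (f y)"
  show "continuous_on UNIV f"
    unfolding continuous_on_open_vimage[OF open_UNIV]
  proof (intro allI impI)
    fix B :: "cantor set" assume "open B"
    then show "open (f -` B \<inter> UNIV)"
      using R unfolding open_cantor_iff by (metis Int_UNIV_right vimage_eq)
  qed
qed

lemma compact_cantor: "compact (UNIV :: cantor set)"
proof -
  have "compact_space (euclidean :: bool topology)"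
    by (simp add: compact_space_def finite_imp_compact)
  then have "compact_space (euclidean :: cantor topology)"
    unfolding euclidean_product_topology[symmetric]
    unfolding compact_space_product_topology by blast
  then show ?thesis
    by (simp add: compact_space_def)
qed

text \<open>
  Compactness enters here: finitely many cylinders on which \<open>c\<close> is constant cover the
  space, and the longest of the words that define them bounds the number of relevant coordinates.
\<close>

lemma locally_constant_imp_uniform:
  fixes c :: "cantor \<Rightarrow> 'l"
  assumes "\<And>x. \<exists>m. \<forall>y. agree m x y \<longrightarrow> c x = c y"
  shows "\<exists>m. \<forall>x y. agree m x y \<longrightarrow> c x = c y"
proof -
  obtain m where m: "\<And>x y. agree (m x) x y \<Longrightarrow> c x = c y" using assms by metis
  have op: "open {y. agree (m x) x y}" for x
    unfolding open_cantor_iff by (auto intro: agree_trans)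
  have "UNIV \<subseteq> (\<Union>x\<in>UNIV. {y. agree (m x) x y})" by auto
  from compactE_image[OF compact_cantor op this]
  obtain X where X: "finite X" "UNIV \<subseteq> (\<Union>x\<in>X. {y. agree (m x) x y})" .
  have "c y = c z" if yz: "agree (Max (m ` X)) y z" for y z
  proof -
    obtain x where x: "x \<in> X" "agree (m x) x y" using X(2) by blast
    have "agree (m x) y z" using yz x(1) X(1) by (auto intro: agree_mono)
    with x(2) have "agree (m x) x z" by (rule agree_trans)
    with x(2) show ?thesis using m by metis
  qed
  then show ?thesis by blast
qed

lemma homeo_iff:
  "f \<in> cantor_homeos \<longleftrightarrow> bij f \<and> continuous_on UNIV f \<and> continuous_on UNIV (inv f)"
proof
  assume "f \<in> cantor_homeos"
  then have h: "homeomorphism UNIV UNIV f (inv f)" by (simp add: cantor_homeos_def)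
  then have "inj f" "surj f"
    unfolding homeomorphism_def by (auto intro: inj_on_inverseI)
  then have "bij f" by (simp add: bij_def)
  with h show "bij f \<and> continuous_on UNIV f \<and> continuous_on UNIV (inv f)"
    by (auto simp: homeomorphism_def)
next
  assume "bij f \<and> continuous_on UNIV f \<and> continuous_on UNIV (inv f)"
  then show "f \<in> cantor_homeos"
    unfolding cantor_homeos_def homeomorphism_def
    by (auto simp: bij_is_inj bij_is_surj surj_f_inv_f bij_imp_bij_inv)
qed

lemma homeoI:
  assumes "\<And>x. g (f x) = x" "\<And>y. f (g y) = y" "continuous_on UNIV f" "continuous_on UNIV g"
  shows "f \<in> cantor_homeos"
proof -
  have "bij f" using assms(1,2) by (metis bijI')
  moreover have "inv f = g" using assms(1,2) by (simp add: inv_equality)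
  ultimately show ?thesis using assms by (simp add: homeo_iff)
qed

text \<open>
  The first \<open>k + 1\<close> coordinates of \<open>f x\<close> are a locally constant function of \<open>x\<close>.
\<close>

lemma continuous_cantor_uniform:
  assumes "continuous_on UNIV f"
  shows "\<exists>m. \<forall>x y. agree m x y \<longrightarrow> agree k (f x) (f y)"
proof -
  have "\<exists>m. \<forall>x y. agree m x y \<longrightarrow> (\<lambda>i. i \<le> k \<and> f x i) = (\<lambda>i. i \<le> k \<and> f y i)"
  proof (rule locally_constant_imp_uniform)
    fix x
    show "\<exists>m. \<forall>y. agree m x y \<longrightarrow> (\<lambda>i. i \<le> k \<and> f x i) = (\<lambda>i. i \<le> k \<and> f y i)"
    proof -
      obtain m where "\<And>y. agree m x y \<Longrightarrow> agree k (f x) (f y)"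
        using assms unfolding continuous_cantor_iff by blast
      then show ?thesis by (intro exI[of _ m]) (auto simp: agree_def fun_eq_iff)
    qed
  qed
  then obtain m where m: "\<And>x y i. agree m x y \<Longrightarrow> (i \<le> k \<and> f x i) = (i \<le> k \<and> f y i)"
    unfolding fun_eq_iff by blast
  then show ?thesis unfolding agree_def[of k] by blast
qed

section \<open>Homeomorphisms with prescribed clopen images\<close>

definition cons :: "bool \<Rightarrow> cantor \<Rightarrow> cantor" where
  "cons b x = (\<lambda>k. case k of 0 \<Rightarrow> b | Suc j \<Rightarrow> x j)"

definition tail :: "cantor \<Rightarrow> cantor" where
  "tail x = (\<lambda>k. x (Suc k))"

lemma cons_simps [simp]: "cons b x 0 = b" "tail (cons b x) = x" "cons (x 0) (tail x) = x"
  by (auto simp: cons_def tail_def fun_eq_iff split: nat.split)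

lemma agree_cons: "agree (Suc k) (cons b x) (cons c y) \<longleftrightarrow> b = c \<and> agree k x y"
proof -
  have "(\<forall>i\<le>Suc k. P i) \<longleftrightarrow> P 0 \<and> (\<forall>i\<le>k. P (Suc i))" for P :: "nat \<Rightarrow> bool"
    by (metis Suc_le_mono le0 not0_implies_Suc)
  then show ?thesis by (simp add: agree_def cons_def)
qed

lemma agree_Suc: "agree (Suc k) x y \<longleftrightarrow> x 0 = y 0 \<and> agree k (tail x) (tail y)"
  by (metis agree_cons cons_simps(3))

lemma continuous_cons: "continuous_on UNIV (cons b)"
  unfolding continuous_cantor_iff
proof (intro allI)
  fix x k
  have "agree k (cons b x) (cons b y)" if "agree k x y" for y
    using agree_cons[of k b x b y] that by (auto intro: agree_mono)
  then show "\<exists>m. \<forall>y. agree m x y \<longrightarrow> agree k (cons b x) (cons b y)" by blast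
qed

lemma continuous_tail: "continuous_on UNIV tail"
  unfolding continuous_cantor_iff
proof (intro allI)
  fix x k
  have "agree k (tail x) (tail y)" if "agree (Suc k) x y" for y
    using that by (simp add: agree_Suc)
  then show "\<exists>m. \<forall>y. agree m x y \<longrightarrow> agree k (tail x) (tail y)" by blast
qed

lemma continuous_comp: "continuous_on UNIV f \<Longrightarrow> continuous_on UNIV g \<Longrightarrow> continuous_on UNIV (\<lambda>x. f (g x))"
  for f g :: "cantor \<Rightarrow> cantor"
  by (metis continuous_on_compose2 subset_UNIV)

text \<open>
  Continuous maps can be glued along the clopen pieces on which a label is constant.
\<close>

lemma continuous_cases:
  fixes c :: "cantor \<Rightarrow> 'l" and F :: "'l \<Rightarrow> cantor \<Rightarrow> cantor"
  assumes c: "\<And>x y. agree m x y \<Longrightarrow> c x = c y" and F: "\<And>x. continuous_on UNIV (F (c x))"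
  shows "continuous_on UNIV (\<lambda>x. F (c x) x)"
  unfolding continuous_cantor_iff
proof (intro allI)
  fix x k
  obtain j where j: "\<And>y. agree j x y \<Longrightarrow> agree k (F (c x) x) (F (c x) y)"
    using F[of x] unfolding continuous_cantor_iff by blast
  have "agree k (F (c x) x) (F (c y) y)" if "agree (max j m) x y" for y
    using j[of y] c[of x y] that by (metis agree_mono max.cobounded1 max.cobounded2)
  then show "\<exists>m. \<forall>y. agree m x y \<longrightarrow> agree k (F (c x) x) (F (c y) y)" by blast
qed

text \<open>
  A homeomorphism of the whole space onto the set \<open>Z\<close>.  The map \<open>\<psi>\<close> extends the
  inverse continuously to the whole space, which spares the use of subspace topologies.
\<close>

definition cantor_chart :: "cantor set \<Rightarrow> (cantor \<Rightarrow> cantor) \<Rightarrow> (cantor \<Rightarrow> cantor) \<Rightarrow> bool" where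
  "cantor_chart Z \<phi> \<psi> \<longleftrightarrow> continuous_on UNIV \<phi> \<and> continuous_on UNIV \<psi> \<and>
     (\<forall>x. \<phi> x \<in> Z \<and> \<psi> (\<phi> x) = x) \<and> (\<forall>z\<in>Z. \<phi> (\<psi> z) = z)"

text \<open>
  Induction on the number of coordinates that decide membership in \<open>Z\<close>.  Cut \<open>Z\<close> by the
  first coordinate; each half is a copy of a set decided by one coordinate less.  If both halves are
  inhabited, glue their charts along the two halves of the space.  If only one is, its chart alone
  will do, since the space need not be cut to be mapped onto a cylinder.
\<close>

lemma clopen_has_cantor_chart:
  assumes "\<And>x y. (\<forall>k<m. x k = y k) \<Longrightarrow> x \<in> Z \<longleftrightarrow> y \<in> Z" and "Z \<noteq> {}"
  shows "\<exists>\<phi> \<psi>. cantor_chart Z \<phi> \<psi>"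
  using assms
proof (induction m arbitrary: Z)
  case 0
  then have "Z = UNIV" by auto
  then have "cantor_chart Z (\<lambda>x. x) (\<lambda>x. x)" by (simp add: cantor_chart_def)
  then show ?case by blast
next
  case (Suc m)
  define H where "H b = {x. cons b x \<in> Z}" for b
  have depth: "x \<in> H b \<longleftrightarrow> y \<in> H b" if "\<forall>k<m. x k = y k" for x y b
  proof -
    have "\<forall>k<Suc m. cons b x k = cons b y k"
      using that by (auto simp: cons_def split: nat.split)
    then show ?thesis using Suc.prems(1) unfolding H_def by blast
  qed
  have mem: "z \<in> Z \<longleftrightarrow> tail z \<in> H (z 0)" for z
    by (simp add: H_def)
  have IH: "\<exists>\<phi> \<psi>. cantor_chart (H b) \<phi> \<psi>" if "H b \<noteq> {}" for b
    using Suc.IH[OF depth that] .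
  show ?case
  proof (cases "\<forall>b. H b \<noteq> {}")
    case True
    with IH obtain \<phi> \<psi> where chart: "\<And>b. cantor_chart (H b) (\<phi> b) (\<psi> b)" by metis
    have c: "continuous_on UNIV (\<phi> b)" "continuous_on UNIV (\<psi> b)"
      and i: "\<phi> b x \<in> H b" "\<psi> b (\<phi> b x) = x" "z \<in> H b \<Longrightarrow> \<phi> b (\<psi> b z) = z" for b x z
      using chart[of b] unfolding cantor_chart_def by simp_all
    \<comment> \<open>The first coordinate is kept and selects the map that is applied to the rest.\<close>
    have glue: "continuous_on UNIV (\<lambda>x. cons (x 0) (F (x 0) (tail x)))"
      if "\<And>b. continuous_on UNIV (F b)" for F :: "bool \<Rightarrow> cantor \<Rightarrow> cantor"
      by (rule continuous_cases[where c = "\<lambda>x. x 0" and F = "\<lambda>b x. cons b (F b (tail x))" and m = 0])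
        (auto simp: agree_def intro: continuous_comp[OF continuous_cons] continuous_comp[OF that continuous_tail])
    have "cantor_chart Z (\<lambda>x. cons (x 0) (\<phi> (x 0) (tail x))) (\<lambda>x. cons (x 0) (\<psi> (x 0) (tail x)))"
      unfolding cantor_chart_def by (intro conjI glue c) (simp_all add: mem i)
    then show ?thesis by blast
  next
    case False
    then obtain b' where "H b' = {}" by blast
    define b where "b = (\<not> b')"
    have b: "H (\<not> b) = {}" using \<open>H b' = {}\<close> by (simp add: b_def)
    have z0: "z 0 = b" if "z \<in> Z" for z
    proof (rule ccontr)
      assume "z 0 \<noteq> b"
      then have "z 0 = (\<not> b)" by simp
      with that b mem[of z] show False by simp
    qed
    obtain z where "z \<in> Z" using \<open>Z \<noteq> {}\<close> by blast
    then have "tail z \<in> H b" using mem[of z] z0[of z] by simp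
    then have "H b \<noteq> {}" by blast
    from IH[OF this] obtain \<phi> \<psi> where chart: "cantor_chart (H b) \<phi> \<psi>" by blast
    then have c: "continuous_on UNIV \<phi>" "continuous_on UNIV \<psi>"
      and i: "\<phi> x \<in> H b" "\<psi> (\<phi> x) = x" "z \<in> H b \<Longrightarrow> \<phi> (\<psi> z) = z" for x z
      unfolding cantor_chart_def by simp_all
    have "cons b (\<phi> (\<psi> (tail z))) = z" if "z \<in> Z" for z
      using that z0[OF that] mem[of z] i(3)[of "tail z"] cons_simps(3)[of z] by simp
    then have "cantor_chart Z (\<lambda>x. cons b (\<phi> x)) (\<lambda>x. \<psi> (tail x))"
      unfolding cantor_chart_def
      by (intro conjI continuous_comp[OF continuous_cons] continuous_comp[OF _ continuous_tail] c)
        (simp_all add: mem i)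
    then show ?thesis by blast
  qed
qed

text \<open>
  For each label map the set \<open>{x. c x = l}\<close> onto \<open>{x. c' x = l}\<close> through the whole Cantor
  space; both sets are inhabited for the same labels, and the pieces glue.
\<close>

lemma homeo_matching_labels:
  fixes c c' :: "cantor \<Rightarrow> 'l"
  assumes c: "\<And>x y. agree m x y \<Longrightarrow> c x = c y" and c': "\<And>x y. agree m x y \<Longrightarrow> c' x = c' y"
    and ran: "range c = range c'"
  obtains g where "g \<in> cantor_homeos" "\<And>x. c' (g x) = c x"
proof -
  have ex: "\<exists>\<phi> \<psi>. cantor_chart {z. e z = l} \<phi> \<psi>"
    if e: "\<And>x y. agree m x y \<Longrightarrow> e x = e y" and l: "l \<in> range e" for e :: "cantor \<Rightarrow> 'l" and l
  proof (rule clopen_has_cantor_chart[of "Suc m"])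
    show "x \<in> {x. e x = l} \<longleftrightarrow> y \<in> {x. e x = l}" if "\<forall>k<Suc m. x k = y k" for x y
      using that e[of x y] by (simp add: agree_def less_Suc_eq_le)
    show "{x. e x = l} \<noteq> {}" using l by blast
  qed
  obtain \<phi> \<psi> where chart: "\<And>l. l \<in> range c \<Longrightarrow> cantor_chart {z. c z = l} (\<phi> l) (\<psi> l)"
    using ex[of c, OF c] by metis
  obtain \<phi>' \<psi>' where chart': "\<And>l. l \<in> range c' \<Longrightarrow> cantor_chart {z. c' z = l} (\<phi>' l) (\<psi>' l)"
    using ex[of c', OF c'] by metis
  have cont: "continuous_on UNIV (\<phi> l)" "continuous_on UNIV (\<psi> l)"
      "continuous_on UNIV (\<phi>' l)" "continuous_on UNIV (\<psi>' l)"
    and i: "c (\<phi> l x) = l" "\<psi> l (\<phi> l x) = x" "c' (\<phi>' l x) = l" "\<psi>' l (\<phi>' l x) = x"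
    if "l \<in> range c" for l x
    using chart[of l] chart'[of l] that ran unfolding cantor_chart_def by simp_all
  have ii: "\<phi> (c z) (\<psi> (c z) z) = z" "\<phi>' (c' z) (\<psi>' (c' z) z) = z" for z
    using chart[of "c z"] chart'[of "c' z"] unfolding cantor_chart_def by simp_all
  have c'_ran: "c' x \<in> range c" for x using ran by blast
  define g where "g = (\<lambda>x. \<phi>' (c x) (\<psi> (c x) x))"
  define h where "h = (\<lambda>y. \<phi> (c' y) (\<psi>' (c' y) y))"
  have g: "c' (g x) = c x" for x by (simp add: g_def i)
  moreover have "g \<in> cantor_homeos"
  proof (rule homeoI)
    show "h (g x) = x" for x
      unfolding h_def g by (simp add: g_def i ii)
    have "c (h y) = c' y" for y by (simp add: h_def i c'_ran)
    then show "g (h y) = y" for y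
      unfolding g_def by (simp add: h_def i ii c'_ran)
    show "continuous_on UNIV g"
      unfolding g_def
      by (rule continuous_cases[where F = "\<lambda>l x. \<phi>' l (\<psi> l x)", OF c])
        (auto intro: continuous_comp cont)
    show "continuous_on UNIV h"
      unfolding h_def
      by (rule continuous_cases[where F = "\<lambda>l x. \<phi> l (\<psi>' l x)", OF c'])
        (auto intro: continuous_comp cont c'_ran)
  qed
  ultimately show thesis using that by blast
qed

section \<open>Past-future labellings exclude Li-Yorke pairs\<close>

text \<open>
  The second component of a label marks the future cells.  The functions \<open>s\<close> and \<open>p\<close>
  compute the next cell on the future and the previous cell on the past.
\<close>

definition past_future_labelling :: "(cantor \<Rightarrow> 'l \<times> bool) \<Rightarrow> (cantor \<Rightarrow> cantor) \<Rightarrow> bool" where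
  "past_future_labelling l f \<longleftrightarrow>
     (\<exists>s. \<forall>x. snd (l x) \<longrightarrow> l (f x) = s (l x) \<and> snd (l (f x))) \<and>
     (\<exists>p. \<forall>x. \<not> snd (l (f x)) \<longrightarrow> l x = p (l (f x)))"

text \<open>
  The labels are fixed to be points with a bit only to have one type for all of them; the points
  that occur below are representatives of cylinders.
\<close>

definition tame :: "nat \<Rightarrow> (cantor \<Rightarrow> cantor) \<Rightarrow> bool" where
  "tame k f \<longleftrightarrow> (\<exists>(l :: cantor \<Rightarrow> cantor \<times> bool) m. past_future_labelling l f \<and>
     (\<forall>x y. agree m x y \<longrightarrow> l x = l y) \<and> (\<forall>x y. l x = l y \<longrightarrow> agree k x y))"

text \<open>
  Agreement at a time when both orbits are in the future propagates forwards by \<open>s\<close>;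
  agreement at a time when both are in the past propagates backwards by \<open>p\<close>, because
  an orbit that is in the past at some time was there at all earlier times.
\<close>

lemma past_future_labelling_eventually_eq:
  assumes l: "past_future_labelling l f"
    and freq: "\<exists>\<^sub>F n in sequentially. l ((f ^^ n) x) = l ((f ^^ n) y)"
  shows "\<forall>\<^sub>F n in sequentially. l ((f ^^ n) x) = l ((f ^^ n) y)"
proof -
  obtain s p where s: "\<And>x. snd (l x) \<Longrightarrow> l (f x) = s (l x)"
    and fut: "\<And>x. snd (l x) \<Longrightarrow> snd (l (f x))"
    and p: "\<And>x. \<not> snd (l (f x)) \<Longrightarrow> l x = p (l (f x))"
    using l unfolding past_future_labelling_def by metis
  define u where "u n = l ((f ^^ n) x)" for n
  define v where "v n = l ((f ^^ n) y)" for n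
  have su: "u (Suc n) = s (u n) \<and> snd (u (Suc n))" if "snd (u n)" for n
    using that s fut by (simp add: u_def)
  have sv: "v (Suc n) = s (v n) \<and> snd (v (Suc n))" if "snd (v n)" for n
    using that s fut by (simp add: v_def)
  have pu: "u n = p (u (Suc n))" if "\<not> snd (u (Suc n))" for n
    using that p by (simp add: u_def)
  have pv: "v n = p (v (Suc n))" if "\<not> snd (v (Suc n))" for n
    using that p by (simp add: v_def)
  have fr: "\<exists>n\<ge>N. u n = v n" for N
    using freq by (simp add: frequently_sequentially u_def v_def)
  have "\<exists>N. \<forall>n\<ge>N. u n = v n"
  proof (cases "\<exists>n. u n = v n \<and> snd (u n)")
    case True
    then obtain N where N: "u N = v N" "snd (u N)" by blast
    have "u n = v n \<and> snd (u n)" if "n \<ge> N" for n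
      using that by (induction n rule: dec_induct) (use N su sv in auto)
    then show ?thesis by blast
  next
    case False
    have "u n = v n" for n
    proof -
      obtain N where N: "N \<ge> n" "u N = v N" using fr by blast
      have "u n = v n \<and> \<not> snd (u n)"
        using N(1)
      proof (induction n rule: inc_induct)
        case base
        with N False show ?case by blast
      next
        case (step j)
        then show ?case using pu[of j] pv[of j] su[of j] by metis
      qed
      then show ?thesis by blast
    qed
    then show ?thesis by blast
  qed
  then show ?thesis by (simp add: eventually_sequentially u_def v_def)
qed

lemma Li_Yorke_pair_imp_agree:
  assumes "Li_Yorke_pair f x y"
  shows "\<exists>\<^sub>F n in sequentially. agree m ((f ^^ n) x) ((f ^^ n) y)"
    and "\<exists>k. \<exists>\<^sub>F n in sequentially. \<not> agree k ((f ^^ n) x) ((f ^^ n) y)"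
proof -
  define d where "d n = ereal (cantor_dist ((f ^^ n) x) ((f ^^ n) y))" for n
  have inf: "liminf d = 0" and sup: "limsup d > 0"
    using assms unfolding Li_Yorke_pair_def d_def by blast+
  have agree: "agree k ((f ^^ n) x) ((f ^^ n) y) \<longleftrightarrow> d n < ereal (1 / real (Suc k))" for k n
    unfolding agree_iff_dist d_def by simp
  show "\<exists>\<^sub>F n in sequentially. agree m ((f ^^ n) x) ((f ^^ n) y)"
  proof (rule ccontr)
    assume "\<not> ?thesis"
    then have "\<forall>\<^sub>F n in sequentially. ereal (1 / real (Suc m)) \<le> d n"
      by (simp add: not_frequently agree not_less)
    then have "ereal (1 / real (Suc m)) \<le> liminf d" by (rule Liminf_bounded)
    with inf show False by simp
  qed
  obtain r where r: "0 < ereal r" "ereal r < limsup d" using ereal_dense2[OF sup] by auto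
  then obtain k where k: "1 / real (Suc k) < r" using nat_approx_posE by auto
  have "\<exists>\<^sub>F n in sequentially. \<not> agree k ((f ^^ n) x) ((f ^^ n) y)"
  proof (rule ccontr)
    assume "\<not> ?thesis"
    then have "\<forall>\<^sub>F n in sequentially. d n < ereal (1 / real (Suc k))"
      by (simp add: not_frequently agree)
    moreover have "d n \<le> ereal r" if "d n < ereal (1 / real (Suc k))" for n
      using that k by (meson ereal_less_eq(3) less_imp_le order_trans)
    ultimately have "\<forall>\<^sub>F n in sequentially. d n \<le> ereal r"
      by (rule eventually_mono)
    then have "limsup d \<le> ereal r" by (rule Limsup_bounded)
    with r show False by simp
  qed
  then show "\<exists>k. \<exists>\<^sub>F n in sequentially. \<not> agree k ((f ^^ n) x) ((f ^^ n) y)" by blast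
qed

lemma tame_imp_no_Li_Yorke_pair:
  assumes "\<And>k. tame k f"
  shows "\<not> Li_Yorke_pair f x y"
proof
  assume LY: "Li_Yorke_pair f x y"
  then obtain k where k: "\<exists>\<^sub>F n in sequentially. \<not> agree k ((f ^^ n) x) ((f ^^ n) y)"
    using Li_Yorke_pair_imp_agree(2) by blast
  obtain l :: "cantor \<Rightarrow> cantor \<times> bool" and m where l: "past_future_labelling l f"
    and m: "\<And>x y. agree m x y \<Longrightarrow> l x = l y" and fine: "\<And>x y. l x = l y \<Longrightarrow> agree k x y"
    using assms[of k] unfolding tame_def by blast
  have "\<exists>\<^sub>F n in sequentially. l ((f ^^ n) x) = l ((f ^^ n) y)"
    using Li_Yorke_pair_imp_agree(1)[OF LY, of m] by (rule frequently_elim1) (rule m)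
  then have "\<forall>\<^sub>F n in sequentially. l ((f ^^ n) x) = l ((f ^^ n) y)"
    by (rule past_future_labelling_eventually_eq[OF l])
  then have "\<forall>\<^sub>F n in sequentially. agree k ((f ^^ n) x) ((f ^^ n) y)"
    by (rule eventually_mono) (rule fine)
  with k show False by (simp add: frequently_def)
qed

text \<open>
  A labelling is transported along \<open>h\<close>.  Uniform continuity of \<open>h\<close> says how fine the
  labelling for \<open>f\<close> must be, which is why tameness at all scales is assumed.
\<close>

lemma tame_conjugate:
  assumes f: "\<And>k. tame k f" and h: "h \<in> cantor_homeos"
  shows "tame k (h \<circ> f \<circ> inv h)"
proof -
  have h': "inv h (h x) = x" "h (inv h x) = x" for x
    using h by (simp_all add: homeo_iff bij_is_inj bij_is_surj surj_f_inv_f)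
  have "continuous_on UNIV h" "continuous_on UNIV (inv h)" using h by (simp_all add: homeo_iff)
  then obtain j where j: "\<And>x y. agree j x y \<Longrightarrow> agree k (h x) (h y)"
    using continuous_cantor_uniform by metis
  obtain l :: "cantor \<Rightarrow> cantor \<times> bool" and m where l: "past_future_labelling l f"
    and m: "\<And>x y. agree m x y \<Longrightarrow> l x = l y" and fine: "\<And>x y. l x = l y \<Longrightarrow> agree j x y"
    using f[of j] unfolding tame_def by blast
  obtain i where i: "\<And>x y. agree i x y \<Longrightarrow> agree m (inv h x) (inv h y)"
    using continuous_cantor_uniform[OF \<open>continuous_on UNIV (inv h)\<close>] by metis
  have "past_future_labelling (l \<circ> inv h) (h \<circ> f \<circ> inv h)"
    using l unfolding past_future_labelling_def by (simp add: h') blast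
  moreover have "(l \<circ> inv h) x = (l \<circ> inv h) y" if "agree i x y" for x y
    using m[OF i[OF that]] by simp
  moreover have "agree k x y" if "(l \<circ> inv h) x = (l \<circ> inv h) y" for x y
    using j[OF fine, of "inv h x" "inv h y"] that by (simp add: h')
  ultimately show ?thesis unfolding tame_def by blast
qed

section \<open>Tameness is open and dense\<close>

lemma tame_mono: "tame k f \<Longrightarrow> j \<le> k \<Longrightarrow> tame j f"
  unfolding tame_def by (meson agree_mono)

text \<open>
  A labelling that works for \<open>f\<close> works for each \<open>g\<close> with \<open>l (g x) = l (f x)\<close> for all
  \<open>x\<close>, and uniformly close maps satisfy this.
\<close>

lemma openin_tame: "openin cantor_homeos_topology {f \<in> cantor_homeos. tame k f}"
  unfolding cantor_homeos_topology_def Cantor_homeos.openin_mtopology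
proof (intro conjI allI impI)
  fix f assume "f \<in> {f \<in> cantor_homeos. tame k f}"
  then obtain l :: "cantor \<Rightarrow> cantor \<times> bool" and m where l: "past_future_labelling l f"
    and m: "\<And>x y. agree m x y \<Longrightarrow> l x = l y" and fine: "\<And>x y. l x = l y \<Longrightarrow> agree k x y"
    unfolding tame_def by blast
  have "tame k g" if "cantor_sup_dist f g < 1 / real (Suc m)" for g
  proof -
    have "l (g x) = l (f x)" for x
      using that m by (metis sup_dist_less_iff)
    then have "past_future_labelling l g" using l unfolding past_future_labelling_def by simp
    with m fine show ?thesis unfolding tame_def by blast
  qed
  then show "\<exists>r>0. Cantor_homeos.mball f r \<subseteq> {f \<in> cantor_homeos. tame k f}"
    by (intro exI[of _ "1 / real (Suc m)"]) (auto simp: subset_iff)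
qed auto

text \<open>
  The representative of the cylinder of \<open>x\<close> whose coordinates beyond \<open>n\<close> vanish.  The
  fibres of this function are the cylinders.
\<close>

definition trunc :: "nat \<Rightarrow> cantor \<Rightarrow> cantor" where
  "trunc n x = (\<lambda>k. k \<le> n \<and> x k)"

lemma trunc_eq_iff: "trunc n x = trunc n y \<longleftrightarrow> agree n x y"
  by (auto simp: trunc_def agree_def fun_eq_iff)

lemma agree_trunc: "agree n (trunc n x) x"
  by (simp add: trunc_def agree_def)

lemma trunc_idem [simp]: "trunc n (trunc n x) = trunc n x"
  unfolding trunc_eq_iff by (rule agree_trunc)

text \<open>
  With \<open>\<pi>\<close> the projection to the representatives, \<open>s\<close> and \<open>p\<close> give a successor and a
  predecessor of each cylinder under \<open>f\<close>, read off at the representative.  A coordinate \<open>M\<close>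
  so late that it affects neither \<open>\<pi> x\<close> nor \<open>\<pi> (f x)\<close> serves as a free bit.  It
  is used to carve out, inside the points that move from \<open>a\<close> to \<open>s a\<close>, the future part
  \<open>Q\<close> of the cylinder \<open>a\<close>, and, disjoint from \<open>Q\<close>, inside the points that move from
  \<open>p b\<close> to \<open>b\<close>, the set \<open>S\<close> of points that will land in the past part of \<open>b\<close>.
  Being free, the bit guarantees that all these sets and their complements within the
  cylinders are inhabited.  So there is a homeomorphism \<open>g\<close> that sends each point to
  the cylinder to which \<open>f\<close> sends it, and exactly the points of \<open>S\<close> into the past.
\<close>

lemma tame_approximation:
  assumes f: "f \<in> cantor_homeos"
  obtains g where "g \<in> cantor_homeos" "tame n g" "\<And>x. agree n (f x) (g x)"
proof -
  have cont: "continuous_on UNIV f" and f': "f (inv f y) = y" "inv f (f x) = x" for x y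
    using f by (simp_all add: homeo_iff bij_is_inj bij_is_surj surj_f_inv_f)
  obtain j where j: "\<And>x y. agree j x y \<Longrightarrow> agree n (f x) (f y)"
    using continuous_cantor_uniform[OF cont] by blast
  define M where "M = Suc (max n j)"
  define \<pi> where "\<pi> = trunc n"
  define s where "s a = \<pi> (f a)" for a
  define p where "p b = \<pi> (inv f b)" for b
  define Q where "Q x \<longleftrightarrow> \<pi> (f x) = s (\<pi> x) \<and> x M" for x
  define S where "S x \<longleftrightarrow> \<pi> x = p (\<pi> (f x)) \<and> \<not> x M" for x
  have \<pi>_agree: "\<pi> x = \<pi> y \<and> \<pi> (f x) = \<pi> (f y)" if "agree (max n j) x y" for x y
    using agree_mono[OF that, of n] j[OF agree_mono[OF that]] unfolding \<pi>_def trunc_eq_iff by simp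
  have \<pi>_upd: "\<pi> (x(M := b)) = \<pi> x" "\<pi> (f (x(M := b))) = \<pi> (f x)" for x b
    using \<pi>_agree[of "x(M := b)" x] by (auto simp: agree_def M_def)
  have local: "\<pi> x = \<pi> y \<and> \<pi> (f x) = \<pi> (f y) \<and> x M = y M" if "agree M x y" for x y
    using that \<pi>_agree[of x y] agree_mono[of M x y "max n j"] by (auto simp: M_def agree_def)
  define c where "c x = (\<pi> (f x), S x)" for x
  define c' where "c' x = (\<pi> x, \<not> Q x)" for x
  \<comment> \<open>Both labellings take all values: adjust the bit \<open>M\<close> of a suitable point.\<close>
  have range_c: "range c = range \<pi> \<times> UNIV"
  proof
    show "range c \<subseteq> range \<pi> \<times> UNIV" by (auto simp: c_def)
    have "(\<pi> b, t) \<in> range c" for b t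
    proof (rule range_eqI)
      show "(\<pi> b, t) = c ((inv f (\<pi> b))(M := \<not> t))"
        by (auto simp: c_def S_def p_def \<pi>_upd f') (simp_all add: \<pi>_def)
    qed
    then show "range \<pi> \<times> UNIV \<subseteq> range c" by blast
  qed
  have range_c': "range c' = range \<pi> \<times> UNIV"
  proof
    show "range c' \<subseteq> range \<pi> \<times> UNIV" by (auto simp: c'_def)
    have "(\<pi> a, t) \<in> range c'" for a t
    proof (rule range_eqI)
      show "(\<pi> a, t) = c' ((\<pi> a)(M := \<not> t))"
        by (auto simp: c'_def Q_def s_def \<pi>_upd) (simp_all add: \<pi>_def)
    qed
    then show "range \<pi> \<times> UNIV \<subseteq> range c'" by blast
  qed
  have "c x = c y" "c' x = c' y" if "agree M x y" for x y
    using local[OF that] by (simp_all add: c_def c'_def S_def Q_def)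
  then obtain g where g: "g \<in> cantor_homeos" "\<And>x. c' (g x) = c x"
    using homeo_matching_labels[of M c c'] range_c range_c' by metis
  then have gf: "\<pi> (g x) = \<pi> (f x)" and QS: "Q (g x) \<longleftrightarrow> \<not> S x" for x
    unfolding c_def c'_def by auto
  define l where "l x = (\<pi> x, Q x)" for x
  have "past_future_labelling l g"
    unfolding past_future_labelling_def
  proof (intro conjI exI allI impI)
    fix x
    \<comment> \<open>The bit \<open>M\<close> is set on \<open>Q\<close> and unset on \<open>S\<close>.\<close>
    have disj: "\<not> (Q x \<and> S x)" by (simp add: Q_def S_def)
    have Qs: "\<pi> (f x) = s (\<pi> x)" if "Q x" using that by (simp add: Q_def)
    have Sp: "\<pi> x = p (\<pi> (f x))" if "S x" using that by (simp add: S_def)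
    show "l (g x) = (s (fst (l x)), True)" if "snd (l x)"
      using that disj Qs by (simp add: l_def gf QS)
    show "snd (l (g x))" if "snd (l x)"
      using that disj by (simp add: l_def QS)
    show "l x = (p (fst (l (g x))), False)" if "\<not> snd (l (g x))"
      using that disj Sp by (simp add: l_def gf QS)
  qed
  moreover have "l x = l y" if "agree M x y" for x y
    using local[OF that] by (simp add: l_def Q_def)
  moreover have "agree n x y" if "l x = l y" for x y
    using that by (simp add: l_def \<pi>_def trunc_eq_iff)
  ultimately have "tame n g" unfolding tame_def by blast
  moreover have "agree n (f x) (g x)" for x
    using gf[of x] by (simp add: \<pi>_def trunc_eq_iff agree_sym)
  ultimately show thesis using g(1) that by blast
qed

lemma closure_of_tame:
  "cantor_homeos_topology closure_of {f \<in> cantor_homeos. tame k f} = cantor_homeos"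
proof -
  have "\<exists>g\<in>{f \<in> cantor_homeos. tame k f}. cantor_sup_dist f g < r"
    if f: "f \<in> cantor_homeos" and "r > 0" for f r
  proof -
    obtain n where n: "1 / real (Suc n) < r" using nat_approx_posE[OF \<open>r > 0\<close>] by auto
    obtain g where g: "g \<in> cantor_homeos" "tame (max k n) g" "\<And>x. agree (max k n) (f x) (g x)"
      using tame_approximation[OF f] by blast
    then have "cantor_sup_dist f g < 1 / real (Suc n)"
      unfolding sup_dist_less_iff by (meson agree_mono max.cobounded2)
    then have "cantor_sup_dist f g < r" using n by linarith
    moreover have "tame k g" using g(2) by (rule tame_mono) simp
    ultimately show ?thesis using g(1) by blast
  qed
  then show ?thesis
    unfolding cantor_homeos_topology_def Cantor_homeos.metric_closure_of by auto
qed

section \<open>A complete metric on the homeomorphism group\<close>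

text \<open>
  The uniform metric is not complete on the homeomorphisms, since a uniform limit of homeomorphisms
  need not be injective.  Controlling the inverses as well repairs this.
\<close>

definition homeo_dist :: "(cantor \<Rightarrow> cantor) \<Rightarrow> (cantor \<Rightarrow> cantor) \<Rightarrow> real" where
  "homeo_dist f g = max (cantor_sup_dist f g) (cantor_sup_dist (inv f) (inv g))"

lemma inv_homeo: "f \<in> cantor_homeos \<Longrightarrow> inv f \<in> cantor_homeos"
  by (simp add: homeo_iff bij_imp_bij_inv inv_inv_eq)

interpretation Homeo: Metric_space cantor_homeos homeo_dist
proof
  fix f g h
  show "0 \<le> homeo_dist f g" by (simp add: homeo_dist_def le_max_iff_disj)
  show "homeo_dist f g = homeo_dist g f"
    by (simp add: homeo_dist_def Cantor_homeos.commute)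
  assume fg: "f \<in> cantor_homeos" "g \<in> cantor_homeos"
  show "homeo_dist f g = 0 \<longleftrightarrow> f = g"
  proof
    assume "homeo_dist f g = 0"
    then have "cantor_sup_dist f g = 0"
      using Cantor_homeos.nonneg[of f g] unfolding homeo_dist_def by linarith
    then show "f = g" using Cantor_homeos.zero[OF fg] by simp
  next
    assume "f = g"
    then show "homeo_dist f g = 0"
      using Cantor_homeos.zero[OF fg] Cantor_homeos.zero[OF fg[THEN inv_homeo]]
      by (simp add: homeo_dist_def)
  qed
  assume h: "h \<in> cantor_homeos"
  show "homeo_dist f h \<le> homeo_dist f g + homeo_dist g h"
    using Cantor_homeos.triangle[OF fg h]
      Cantor_homeos.triangle[OF inv_homeo[OF fg(1)] inv_homeo[OF fg(2)] inv_homeo[OF h]]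
    unfolding homeo_dist_def by linarith
qed

lemma homeo_dist_less_iff:
  "homeo_dist f g < 1 / real (Suc n) \<longleftrightarrow>
     (\<forall>x. agree n (f x) (g x)) \<and> (\<forall>x. agree n (inv f x) (inv g x))"
  unfolding homeo_dist_def max_less_iff_conj sup_dist_less_iff ..

text \<open>
  Inversion is continuous at \<open>f\<close>: if \<open>g\<close> is close to \<open>f\<close>, then \<open>f (inv g y)\<close> is
  close to \<open>y\<close>, and uniform continuity of \<open>inv f\<close> makes \<open>inv g y\<close> close to \<open>inv f y\<close>.
\<close>

lemma homeo_dist_topology: "Homeo.mtopology = cantor_homeos_topology"
proof -
  have "openin Homeo.mtopology U \<longleftrightarrow> openin Cantor_homeos.mtopology U" for U
  proof
    assume U: "openin Cantor_homeos.mtopology U"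
    have "Homeo.mball f r \<subseteq> Cantor_homeos.mball f r" for f r
      by (auto simp: homeo_dist_def)
    with U show "openin Homeo.mtopology U"
      unfolding Cantor_homeos.openin_mtopology Homeo.openin_mtopology by (meson order_trans)
  next
    assume U: "openin Homeo.mtopology U"
    show "openin Cantor_homeos.mtopology U"
      unfolding Cantor_homeos.openin_mtopology
    proof (intro conjI allI impI)
      show "U \<subseteq> cantor_homeos" using U unfolding Homeo.openin_mtopology by blast
      fix f assume fU: "f \<in> U"
      with U obtain r where f: "f \<in> cantor_homeos" and r: "r > 0" "Homeo.mball f r \<subseteq> U"
        unfolding Homeo.openin_mtopology by blast
      obtain n where n: "1 / real (Suc n) < r" using nat_approx_posE[OF r(1)] by auto
      have "continuous_on UNIV (inv f)" using f by (simp add: homeo_iff)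
      then obtain m where m: "\<And>x y. agree m x y \<Longrightarrow> agree n (inv f x) (inv f y)"
        using continuous_cantor_uniform by metis
      have "g \<in> U" if g: "g \<in> cantor_homeos" and d: "cantor_sup_dist f g < 1 / real (Suc (max m n))" for g
      proof -
        have ag: "agree (max m n) (f x) (g x)" for x using d unfolding sup_dist_less_iff by blast
        have "agree n (inv f y) (inv g y)" for y
        proof -
          have "inv f (f (inv g y)) = inv g y" "g (inv g y) = y"
            using f g by (simp_all add: homeo_iff bij_is_inj bij_is_surj surj_f_inv_f)
          then show ?thesis
            using m[of "f (inv g y)" y] agree_mono[OF ag[of "inv g y"], of m] by (simp add: agree_sym)
        qed
        moreover have "agree n (f x) (g x)" for x using ag[of x] by (rule agree_mono) simp
        ultimately have "homeo_dist f g < 1 / real (Suc n)" unfolding homeo_dist_less_iff by blast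
        then show "g \<in> U" using n r(2) f g by (auto simp: subset_iff)
      qed
      then show "\<exists>r>0. Cantor_homeos.mball f r \<subseteq> U"
        by (intro exI[of _ "1 / real (Suc (max m n))"]) (auto simp: subset_iff)
    qed
  qed
  then show ?thesis unfolding cantor_homeos_topology_def by (simp add: topology_eq)
qed

lemma uniform_limit_exists:
  fixes \<sigma> :: "nat \<Rightarrow> cantor \<Rightarrow> cantor"
  assumes "\<And>k. \<exists>N. \<forall>n\<ge>N. \<forall>n'\<ge>N. \<forall>x. agree k (\<sigma> n x) (\<sigma> n' x)"
  shows "\<exists>F. \<forall>k. \<exists>N. \<forall>n\<ge>N. \<forall>x. agree k (\<sigma> n x) (F x)"
proof -
  obtain N where N: "\<And>k n n' x. n \<ge> N k \<Longrightarrow> n' \<ge> N k \<Longrightarrow> agree k (\<sigma> n x) (\<sigma> n' x)"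
    using assms by metis
  \<comment> \<open>Coordinate \<open>i\<close> no longer changes from index \<open>N i\<close> on.\<close>
  have "agree k (\<sigma> n x) (\<lambda>i. \<sigma> (N i) x i)" if "n \<ge> Max (N ` {..k})" for k n x
    unfolding agree_def
  proof (intro allI impI)
    fix i assume "i \<le> k"
    then have "N i \<le> n" using that by simp
    then have "agree i (\<sigma> n x) (\<sigma> (N i) x)" using N by blast
    then show "\<sigma> n x i = \<sigma> (N i) x i" by (simp add: agree_def)
  qed
  then show ?thesis by (intro exI[of _ "\<lambda>x i. \<sigma> (N i) x i"]) blast
qed

lemma uniform_limit_continuous:
  fixes \<sigma> :: "nat \<Rightarrow> cantor \<Rightarrow> cantor"
  assumes lim: "\<And>k. \<exists>N. \<forall>n\<ge>N. \<forall>x. agree k (\<sigma> n x) (F x)"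
    and cont: "\<And>n. continuous_on UNIV (\<sigma> n)"
  shows "continuous_on UNIV F"
  unfolding continuous_cantor_iff
proof (intro allI)
  fix x k
  obtain N where N: "\<And>x. agree k (\<sigma> N x) (F x)" using lim[of k] by blast
  obtain m where "\<And>y. agree m x y \<Longrightarrow> agree k (\<sigma> N x) (\<sigma> N y)"
    using cont[of N] unfolding continuous_cantor_iff by blast
  then have "agree k (F x) (F y)" if "agree m x y" for y
    using N[of x] N[of y] that by (meson agree_sym agree_trans)
  then show "\<exists>m. \<forall>y. agree m x y \<longrightarrow> agree k (F x) (F y)" by blast
qed

text \<open>
  Applied in both orders to a sequence of homeomorphisms and the sequence of their inverses, this
  shows that the two uniform limits are inverse to each other.
\<close>

lemma uniform_limit_left_inverse:
  fixes \<sigma> \<tau> :: "nat \<Rightarrow> cantor \<Rightarrow> cantor"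
  assumes F: "\<And>k. \<exists>N. \<forall>n\<ge>N. \<forall>x. agree k (\<sigma> n x) (F x)"
    and G: "\<And>k. \<exists>N. \<forall>n\<ge>N. \<forall>x. agree k (\<tau> n x) (G x)"
    and cont: "continuous_on UNIV F" and inv: "\<And>n x. \<sigma> n (\<tau> n x) = x"
  shows "F (G x) = x"
proof (rule agree_all_imp_eq)
  fix k
  obtain m where m: "\<And>y. agree m (G x) y \<Longrightarrow> agree k (F (G x)) (F y)"
    using cont unfolding continuous_cantor_iff by blast
  obtain N where N: "\<And>n x. n \<ge> N \<Longrightarrow> agree k (\<sigma> n x) (F x)" using F by blast
  obtain N' where N': "\<And>n x. n \<ge> N' \<Longrightarrow> agree m (\<tau> n x) (G x)" using G by blast
  define n where "n = max N N'"
  have "agree k (F (G x)) (F (\<tau> n x))" by (rule m, rule agree_sym, rule N') (simp add: n_def)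
  moreover have "agree k (F (\<tau> n x)) x" using N[of n "\<tau> n x"] inv by (simp add: n_def agree_sym)
  ultimately show "agree k (F (G x)) x" by (rule agree_trans)
qed

lemma homeo_dist_complete: "Homeo.mcomplete"
  unfolding Homeo.mcomplete_def
proof (intro allI impI)
  fix \<sigma> assume C: "Homeo.MCauchy \<sigma>"
  then have hom: "\<sigma> n \<in> cantor_homeos" for n unfolding Homeo.MCauchy_def by blast
  have C': "\<exists>N. \<forall>n\<ge>N. \<forall>n'\<ge>N. homeo_dist (\<sigma> n) (\<sigma> n') < 1 / real (Suc k)" for k
    using C unfolding Homeo.MCauchy_def by (metis of_nat_0_less_iff zero_less_Suc zero_less_divide_1_iff)
  have "\<exists>N. \<forall>n\<ge>N. \<forall>n'\<ge>N. \<forall>x. agree k (\<sigma> n x) (\<sigma> n' x)" for k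
    using C'[of k] unfolding homeo_dist_less_iff by blast
  from uniform_limit_exists[OF this]
  obtain F where F: "\<And>k. \<exists>N. \<forall>n\<ge>N. \<forall>x. agree k (\<sigma> n x) (F x)" by blast
  have "\<exists>N. \<forall>n\<ge>N. \<forall>n'\<ge>N. \<forall>x. agree k (inv (\<sigma> n) x) (inv (\<sigma> n') x)" for k
    using C'[of k] unfolding homeo_dist_less_iff by blast
  from uniform_limit_exists[of "\<lambda>n. inv (\<sigma> n)", OF this]
  obtain G where G: "\<And>k. \<exists>N. \<forall>n\<ge>N. \<forall>x. agree k (inv (\<sigma> n) x) (G x)" by blast
  have inv: "\<sigma> n (inv (\<sigma> n) x) = x" "inv (\<sigma> n) (\<sigma> n x) = x" for n x
    using hom[of n] by (simp_all add: homeo_iff bij_is_inj bij_is_surj surj_f_inv_f)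
  have cont: "continuous_on UNIV (\<sigma> n)" "continuous_on UNIV (inv (\<sigma> n))" for n
    using hom[of n] by (simp_all add: homeo_iff)
  have contF: "continuous_on UNIV F" using F cont(1) by (rule uniform_limit_continuous)
  have contG: "continuous_on UNIV G" using G cont(2) by (rule uniform_limit_continuous)
  have FG: "F (G x) = x" for x using F G contF inv(1) by (rule uniform_limit_left_inverse)
  have GF: "G (F x) = x" for x using G F contG inv(2) by (rule uniform_limit_left_inverse)
  have F_homeo: "F \<in> cantor_homeos" using GF FG contF contG by (rule homeoI)
  have inv_F: "inv F = G" using GF FG by (simp add: inv_equality)
  have "\<exists>N. \<forall>n\<ge>N. \<sigma> n \<in> cantor_homeos \<and> homeo_dist (\<sigma> n) F < r" if "r > 0" for r
  proof -
    obtain k where k: "1 / real (Suc k) < r" using nat_approx_posE[OF \<open>r > 0\<close>] by auto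
    obtain N where N: "\<And>n x. n \<ge> N \<Longrightarrow> agree k (\<sigma> n x) (F x)" using F by blast
    obtain N' where N': "\<And>n x. n \<ge> N' \<Longrightarrow> agree k (inv (\<sigma> n) x) (G x)" using G by blast
    have "homeo_dist (\<sigma> n) F < r" if "n \<ge> max N N'" for n
    proof -
      have "homeo_dist (\<sigma> n) F < 1 / real (Suc k)"
        unfolding homeo_dist_less_iff inv_F using N N' that by simp
      with k show ?thesis by linarith
    qed
    with hom show ?thesis by blast
  qed
  then show "\<exists>F. limitin Homeo.mtopology \<sigma> F sequentially"
    unfolding Homeo.limit_metric_sequentially using F_homeo by blast
qed

section \<open>Comeager conjugacy classes\<close>

text \<open>
  The complements of the closures of the nowhere dense sets that cover the complement of \<open>C\<close> are
  open and dense too, so Baire's theorem yields a point in all of these and in all \<open>U n\<close>.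
\<close>

lemma comeager_Int_dense_open_nonempty:
  assumes C: "comeager_in cantor_homeos_topology C"
    and U: "\<And>n::nat. openin cantor_homeos_topology (U n)"
      "\<And>n. cantor_homeos_topology closure_of (U n) = topspace cantor_homeos_topology"
  shows "\<exists>f\<in>C. \<forall>n. f \<in> U n"
proof -
  let ?X = cantor_homeos_topology
  have top: "topspace ?X = cantor_homeos"
    by (simp add: cantor_homeos_topology_def)
  obtain N :: "nat \<Rightarrow> _" where N: "\<And>n. nowhere_dense_in ?X (N n)" "cantor_homeos - C = (\<Union>n. N n)"
    using C unfolding comeager_in_def meager_in_def top by blast
  define V where "V n = topspace ?X - ?X closure_of (N n)" for n
  have V: "openin ?X (V n) \<and> ?X closure_of (V n) = topspace ?X" for n
    using N(1)[of n] unfolding V_def nowhere_dense_in_def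
    by (auto simp: closure_of_complement openin_diff)
  have "?X closure_of \<Inter>(range U \<union> range V) = topspace ?X"
  proof (rule Baire_category)
    show "completely_metrizable_space ?X \<or> locally_compact_space ?X \<and> regular_space ?X"
      using Homeo.completely_metrizable_space_mtopology[OF homeo_dist_complete] homeo_dist_topology
      by simp
    show "countable (range U \<union> range V)" by simp
    show "openin ?X T \<and> ?X closure_of T = topspace ?X" if "T \<in> range U \<union> range V" for T
      using that U V by auto
  qed
  moreover have "id \<in> cantor_homeos" by (rule homeoI[of id]) simp_all
  ultimately have "\<Inter>(range U \<union> range V) \<noteq> {}" using top by (metis closure_of_empty empty_iff)
  then obtain f where "f \<in> \<Inter>(range U \<union> range V)" by (meson ex_in_conv)
  then have fU: "f \<in> U n" and fV: "f \<in> V n" for n by simp_all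
  have f: "f \<in> topspace ?X" using fU openin_subset[OF U(1)] by blast
  have "f \<notin> N n" for n
    using fV[of n] N(1)[of n] closure_of_subset[of "N n" ?X]
    unfolding V_def nowhere_dense_in_def by blast
  then have "f \<in> C" using N(2) f top by blast
  with fU show ?thesis by blast
qed

lemma homeo_comp:
  assumes f: "f \<in> cantor_homeos" and g: "g \<in> cantor_homeos"
  shows "f \<circ> g \<in> cantor_homeos"
proof (rule homeoI[of "inv g \<circ> inv f"])
  show "(inv g \<circ> inv f) ((f \<circ> g) x) = x" "(f \<circ> g) ((inv g \<circ> inv f) x) = x" for x
    using f g by (simp_all add: homeo_iff bij_is_inj bij_is_surj surj_f_inv_f)
  show "continuous_on UNIV (f \<circ> g)" "continuous_on UNIV (inv g \<circ> inv f)"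
    using f g unfolding o_def by (simp_all add: homeo_iff continuous_comp)
qed

lemma conjugacy_class_conjugate:
  assumes "conjugacy_class C" "f \<in> C" "g \<in> C"
  obtains h where "h \<in> cantor_homeos" "g = h \<circ> f \<circ> inv h"
proof -
  obtain e where C: "C = {h \<circ> e \<circ> inv h | h. h \<in> cantor_homeos}"
    using assms(1) unfolding conjugacy_class_def by blast
  obtain a where a: "a \<in> cantor_homeos" "f = a \<circ> e \<circ> inv a" using assms(2) unfolding C by blast
  obtain b where b: "b \<in> cantor_homeos" "g = b \<circ> e \<circ> inv b" using assms(3) unfolding C by blast
  have bij: "bij a" "bij b" using a b by (simp_all add: homeo_iff)
  then have inv: "inv (b \<circ> inv a) = a \<circ> inv b"
    by (simp add: o_inv_distrib bij_imp_bij_inv inv_inv_eq)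
  have "inv a (a x) = x" for x using bij by (simp add: bij_is_inj)
  then have "g = (b \<circ> inv a) \<circ> f \<circ> inv (b \<circ> inv a)"
    unfolding inv by (intro ext) (simp add: a b)
  moreover have "b \<circ> inv a \<in> cantor_homeos" using a b by (intro homeo_comp inv_homeo)
  ultimately show thesis using that by blast
qed

theorem theorem4p2:
  assumes "conjugacy_class C"
    and "comeager_in cantor_homeos_topology C"
    and "f \<in> C"
  shows "\<not> (\<exists>x y. Li_Yorke_pair f x y)"
proof -
  have "topspace cantor_homeos_topology = cantor_homeos"
    by (simp add: cantor_homeos_topology_def)
  then have "\<exists>g\<in>C. \<forall>k. g \<in> {f \<in> cantor_homeos. tame k f}"
    by (intro comeager_Int_dense_open_nonempty[OF assms(2)] openin_tame) (simp add: closure_of_tame)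
  then obtain g where "g \<in> C" and g: "\<And>k. tame k g" by blast
  obtain h where "h \<in> cantor_homeos" "f = h \<circ> g \<circ> inv h"
    using conjugacy_class_conjugate[OF assms(1) \<open>g \<in> C\<close> assms(3)] .
  then have "tame k f" for k using tame_conjugate[OF g] by simp
  then show ?thesis using tame_imp_no_Li_Yorke_pair by blast
qed

end
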